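(* Let $D$ be an $(s^{n-k}:s^p)$ RME design. Let $J=n(s^{n-k-p-1}-1)(s^{n-k-p}-1)^{-1}$ and let $\eta$ be the fractional part of $J$. Then $$A_{2,1}(D)\ \ge\ [2(s-1)]^{-1}\Big\{-n(n+s-1)+s^{-(n-k-p-2)}\big[n^2+(s^{n-k-p}-1)\big(J^2+\eta(1-\eta)\big)\big]\Big\}.$$
   Context: Let $s$ be a prime power, $GF(s)$ the field with $s$ elements, and $V_m$ the space of row vectors of length $m$ over $GF(s)$. Let $n,k,p$ be integers with $n\ge1$, $k\ge0$, $n-k\ge 1$, $p\ge 1$; write $N=s^{n-k}$ and $L_q=(s^q-1)/(s-1)$. Designs. A regular $s^{n-k}$ design is the $N\times n$ matrix $D_T$ whose rows are the vectors $uT$, $u\in V_{n-k}$, where $T$ is an $(n-k)\times n$ matrix over $GF(s)$ of full row rank. A regular $(s^{n-k}:s^p)$ design $D$ is specified by such a $T$ together with an $(n-k)\times p$ matrix $B$ over $GF(s)$ of full column rank; its blocks are the sets $\{uT: u\in V_{n-k},\,uB=v\}$, one for each $v\in V_p$. If $b_1,\dots,b_p$ are the columns of $B$, let $F$ be the $(n-k)\times L_p$ matrix whose columns are all combinations $\lambda_1b_1+\cdots+\lambda_pb_p$ with $\lambda_i\in GF(s)$, not all zero, the first nonzero $\lambda_i$ being $1$. Wordlength patterns. Let $wt$ denote the Hamming weight. $A_{i,0}(D)=(s-1)^{-1}\#\{w\in V_n: Tw'=0,\ wt(w)=i\}$ is the number of words of length $i$ in the treatment defining contrast subgroup (up to nonzero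 scalars). $A_{i,1}(D)=(s-1)^{-1}\#\{(w_1,w_2)\in V_n\times V_{L_p}: Tw_1'+Fw_2'=0,\ wt(w_1)=i,\ wt(w_2)=1\}$ is the number of treatment words of length $i$ confounded with block effects. $D$ is a regular main effect (RME) design if no main effect is aliased with another main effect or confounded with a block effect, i.e. $A_{1,0}(D)=A_{2,0}(D)=A_{1,1}(D)=0$; equivalently the columns of $T$ are nonzero, pairwise non-proportional, and none lies in the column space of $B$. (This forces $p\le n-k-1$.) *)

theory Defs
  imports "HOL-Library.Cardinality" "Jordan_Normal_Form.DL_Rank"
begin

text \<open>
  GF(s) is a type \<open>'a\<close> of class \<open>{finite, field}\<close> with \<open>s = CARD('a)\<close>. A regular
  (s^(n-k) : s^p) design is represented by the pair of matrices (T, B) specifying it: its runs are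
  the row vectors uT and its blocks the sets of all uT with uB = v. Row vectors w enter the
  wordlength patterns only through the products Tw', which are written \<open>T *\<^sub>v w\<close>.
\<close>

definition regular_block_design :: "nat \<Rightarrow> nat \<Rightarrow> nat \<Rightarrow> 'a::{finite,field} mat \<Rightarrow> 'a mat \<Rightarrow> bool" where
  "regular_block_design n k p T B \<longleftrightarrow>
     T \<in> carrier_mat (n - k) n \<and> vec_space.rank (n - k) T = n - k \<and>
     B \<in> carrier_mat (n - k) p \<and> vec_space.rank (n - k) B = p"

definition L :: "nat \<Rightarrow> nat \<Rightarrow> nat" where
  "L s q = (s ^ q - 1) div (s - 1)"

definition hamming_weight :: "'a::zero vec \<Rightarrow> nat" where
  "hamming_weight w = card {i. i < dim_vec w \<and> w $ i \<noteq> 0}"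

text \<open>Coefficient vectors that are not zero and whose first nonzero entry is 1.\<close>

definition normalized_vecs :: "nat \<Rightarrow> 'a::{zero,one} vec set" where
  "normalized_vecs p = {l \<in> carrier_vec p. \<exists>i<p. l $ i = 1 \<and> (\<forall>j<i. l $ j = 0)}"

text \<open>
  The matrix F. Its columns are determined only up to their order, which is immaterial for the
  wordlength patterns, so an arbitrary enumeration of the coefficient vectors is chosen; see
  \<open>confounding_matrix_props\<close> below.
\<close>

definition confounding_matrix :: "'a::{finite,field} mat \<Rightarrow> 'a mat" where
  "confounding_matrix B =
     mat_of_cols (dim_row B)
       (map (\<lambda>l. B *\<^sub>v l) (SOME ls. distinct ls \<and> set ls = normalized_vecs (dim_col B)))"

text \<open>\<open>A0 T i\<close> and \<open>A1 T B i\<close> are the wordlength patterns A_{i,0}(D) and A_{i,1}(D).\<close>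

definition A0 :: "'a::{finite,field} mat \<Rightarrow> nat \<Rightarrow> real" where
  "A0 T i =
     real (card {w \<in> carrier_vec (dim_col T).
                   T *\<^sub>v w = 0\<^sub>v (dim_row T) \<and> hamming_weight w = i})
     / (real CARD('a) - 1)"

definition A1 :: "'a::{finite,field} mat \<Rightarrow> 'a mat \<Rightarrow> nat \<Rightarrow> real" where
  "A1 T B i =
     real (card {(w1, w2). w1 \<in> carrier_vec (dim_col T) \<and> w2 \<in> carrier_vec (L CARD('a) (dim_col B)) \<and>
                   T *\<^sub>v w1 + confounding_matrix B *\<^sub>v w2 = 0\<^sub>v (dim_row T) \<and>
                   hamming_weight w1 = i \<and> hamming_weight w2 = 1})
     / (real CARD('a) - 1)"

definition RME :: "'a::{finite,field} mat \<Rightarrow> 'a mat \<Rightarrow> bool" where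
  "RME T B \<longleftrightarrow> A0 T 1 = 0 \<and> A0 T 2 = 0 \<and> A1 T B 1 = 0"

lemma carrier_vec_Suc_eq:
  "(carrier_vec (Suc n) :: 'a vec set) = (\<lambda>(a, v). vCons a v) ` (UNIV \<times> carrier_vec n)"
proof
  show "(carrier_vec (Suc n) :: 'a vec set) \<subseteq> (\<lambda>(a, v). vCons a v) ` (UNIV \<times> carrier_vec n)"
  proof
    fix v :: "'a vec" assume "v \<in> carrier_vec (Suc n)"
    then show "v \<in> (\<lambda>(a, v). vCons a v) ` (UNIV \<times> carrier_vec n)"
    proof (cases v)
      case (vCons a w)
      with \<open>v \<in> carrier_vec (Suc n)\<close> have "w \<in> carrier_vec n" by simp
      then have "(a, w) \<in> UNIV \<times> carrier_vec n" by simp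
      then show ?thesis unfolding vCons by (metis (no_types, lifting) case_prod_conv image_eqI)
    qed simp
  qed
qed auto

lemma card_carrier_vec_finite:
  "finite (carrier_vec n :: 'a::finite vec set) \<and> card (carrier_vec n :: 'a vec set) = CARD('a) ^ n"
proof (induction n)
  case 0
  have "carrier_vec 0 = {vNil :: 'a vec}" by auto
  then show ?case by simp
next
  case (Suc n)
  have "inj_on (\<lambda>(a, v). vCons a v) (UNIV \<times> (carrier_vec n :: 'a vec set))"
    by (auto simp: inj_on_def)
  then show ?case
    using Suc by (simp add: carrier_vec_Suc_eq card_image card_cartesian_product)
qed

lemma normalized_vecs_Suc:
  "normalized_vecs (Suc p) =
     vCons 0 ` normalized_vecs p \<union> vCons 1 ` (carrier_vec p :: 'a::zero_neq_one vec set)"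
  (is "?A = ?B")
proof
  show "?A \<subseteq> ?B"
  proof
    fix l :: "'a vec" assume l: "l \<in> ?A"
    then have "l \<in> carrier_vec (Suc p)" by (simp add: normalized_vecs_def)
    then obtain a v where lv: "l = vCons a v" "v \<in> carrier_vec p"
      by (auto simp: carrier_vec_Suc_eq)
    from l obtain i where i: "i < Suc p" "l $ i = 1" "\<forall>j<i. l $ j = 0"
      by (auto simp: normalized_vecs_def)
    show "l \<in> ?B"
    proof (cases i)
      case 0
      then show ?thesis using i lv by auto
    next
      case (Suc m)
      have "a = 0" using i(3) lv Suc by auto
      moreover have "v $ m = 1" using i(2) lv Suc by simp
      moreover have "\<forall>j<m. v $ j = 0"
      proof (intro allI impI)
        fix j assume "j < m"
        then have "l $ Suc j = 0" using i(3) Suc by blast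
        then show "v $ j = 0" using lv by simp
      qed
      ultimately show ?thesis using lv i(1) Suc by (auto simp: normalized_vecs_def)
    qed
  qed
  show "?B \<subseteq> ?A"
  proof
    fix l :: "'a vec" assume "l \<in> ?B"
    then consider v where "l = vCons 0 v" "v \<in> normalized_vecs p"
      | v where "l = vCons 1 v" "v \<in> carrier_vec p" by auto
    then show "l \<in> ?A"
    proof cases
      case 1
      then obtain i where i: "v \<in> carrier_vec p" "i < p" "v $ i = 1" "\<forall>j<i. v $ j = 0"
        by (auto simp: normalized_vecs_def)
      have "\<forall>j<Suc i. l $ j = 0"
        using 1 i by (auto simp: less_Suc_eq_0_disj)
      then show ?thesis using 1 i
        by (auto simp: normalized_vecs_def intro!: exI[of _ "Suc i"])
    next
      case 2
      then show ?thesis by (auto simp: normalized_vecs_def intro!: exI[of _ 0])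
    qed
  qed
qed

lemma card_normalized_vecs:
  "finite (normalized_vecs p :: 'a::{finite,field} vec set) \<and>
   card (normalized_vecs p :: 'a vec set) = L CARD('a) p"
proof -
  have sum: "finite (normalized_vecs p :: 'a vec set) \<and>
      card (normalized_vecs p :: 'a vec set) = (\<Sum>i<p. CARD('a) ^ i)"
  proof (induction p)
    case 0
    then show ?case by (simp add: normalized_vecs_def)
  next
    case (Suc p)
    have fin: "finite (carrier_vec p :: 'a vec set)"
      and card: "card (carrier_vec p :: 'a vec set) = CARD('a) ^ p"
      using card_carrier_vec_finite by auto
    have inj: "inj_on (vCons a) S" for a :: 'a and S by (auto simp: inj_on_def)
    have disj: "vCons 0 ` normalized_vecs p \<inter> vCons 1 ` (carrier_vec p :: 'a vec set) = {}" by auto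
    show ?case
      using Suc fin by (simp add: normalized_vecs_Suc card_Un_disjoint[OF _ _ disj] card_image[OF inj] card)
  qed
  have "card {0::'a, 1} \<le> CARD('a)" by (rule card_mono) auto
  then have s: "CARD('a) - 1 > 0" by simp
  have "CARD('a) ^ p - 1 = (CARD('a) - 1) * (\<Sum>i<p. CARD('a) ^ i)"
  proof -
    have "int (CARD('a) ^ p - 1) = int CARD('a) ^ p - 1" by (simp add: of_nat_diff)
    also have "\<dots> = (int CARD('a) - 1) * (\<Sum>i<p. int CARD('a) ^ i)" by (rule power_diff_1_eq)
    also have "\<dots> = int ((CARD('a) - 1) * (\<Sum>i<p. CARD('a) ^ i))" using s by (simp add: of_nat_diff)
    finally show ?thesis by linarith
  qed
  then show ?thesis using sum s by (simp add: L_def)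
qed

lemma confounding_matrix_props:
  fixes B :: "'a::{finite,field} mat"
  shows "confounding_matrix B \<in> carrier_mat (dim_row B) (L CARD('a) (dim_col B))"
    and "\<exists>e. bij_betw e {..<L CARD('a) (dim_col B)} (normalized_vecs (dim_col B)) \<and>
           (\<forall>j<L CARD('a) (dim_col B). col (confounding_matrix B) j = B *\<^sub>v e j)"
proof -
  define ls where "ls = (SOME ls. distinct ls \<and> set ls = (normalized_vecs (dim_col B) :: 'a vec set))"
  have "\<exists>ls. distinct ls \<and> set ls = (normalized_vecs (dim_col B) :: 'a vec set)"
    using finite_distinct_list card_normalized_vecs by blast
  then have ls: "distinct ls \<and> set ls = normalized_vecs (dim_col B)"
    unfolding ls_def by (rule someI_ex)
  then have len: "length ls = L CARD('a) (dim_col B)"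
    using card_normalized_vecs distinct_card by metis
  have F: "confounding_matrix B = mat_of_cols (dim_row B) (map (\<lambda>l. B *\<^sub>v l) ls)"
    by (simp add: confounding_matrix_def ls_def)
  show "confounding_matrix B \<in> carrier_mat (dim_row B) (L CARD('a) (dim_col B))"
    using len by (simp add: F mat_of_cols_def)
  have "bij_betw (\<lambda>j. ls ! j) {..<L CARD('a) (dim_col B)} (normalized_vecs (dim_col B))"
    using bij_betw_nth[of ls] ls len by simp
  moreover have "\<forall>j<L CARD('a) (dim_col B). col (confounding_matrix B) j = B *\<^sub>v (ls ! j)"
  proof (intro allI impI)
    fix j assume "j < L CARD('a) (dim_col B)"
    then have j: "j < length ls" using len by simp
    have "B *\<^sub>v (ls ! j) \<in> carrier_vec (dim_row B)" by (rule carrier_vecI) simp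
    then show "col (confounding_matrix B) j = B *\<^sub>v (ls ! j)"
      using j col_mat_of_cols[of j "map (\<lambda>l. B *\<^sub>v l) ls" "dim_row B"] by (simp add: F)
  qed
  ultimately show "\<exists>e. bij_betw e {..<L CARD('a) (dim_col B)} (normalized_vecs (dim_col B)) \<and>
      (\<forall>j<L CARD('a) (dim_col B). col (confounding_matrix B) j = B *\<^sub>v e j)"
    by blast
qed

end

theory Submission
  imports Defs
begin

text \<open>
  Write \<open>m = n - k\<close>, let \<open>W\<close> be the column space of \<open>B\<close> and \<open>r = m - p\<close> the dimension of the quotient
  of the \<open>m\<close>-dimensional space by \<open>W\<close>. In an RME design no column \<open>t\<^sub>i\<close> of \<open>T\<close> lies in \<open>W\<close>, so each
  column has a nonzero image in the quotient. A word of length 2 on the positions \<open>i < j\<close> is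
  confounded with a block effect exactly if these two images are proportional, and then its \<open>s - 1\<close>
  nonzero multiples count as one. Hence \<open>A\<^sub>2\<^sub>,\<^sub>1\<close> is the number \<open>P\<close> of unordered pairs of columns
  with proportional images; only the inequality \<open>P \<le> A\<^sub>2\<^sub>,\<^sub>1\<close> is proved here
  (\<open>A1_two_ge_equivalent_pairs\<close>), since it suffices.

  To bound \<open>P\<close> from below, count columns on hyperplanes of the quotient. Its linear functionals are
  the \<open>s^r\<close> vectors \<open>y\<close> orthogonal to \<open>W\<close>; let \<open>N\<^sub>y\<close> be the number of columns that \<open>y\<close> annihilates. A
  column is annihilated by \<open>s^(r-1)\<close> of the functionals, a pair of columns by \<open>s^(r-1)\<close> if the images
  are proportional and by \<open>s^(r-2)\<close> otherwise (\<open>card_orth_hyperplane\<close>, \<open>card_orth_two_hyperplanes\<close>).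
  Double counting turns this into the first two moments of \<open>N\<close> (\<open>hyperplane_moments\<close>): the mean of
  \<open>N\<^sub>y\<close> over \<open>y \<noteq> 0\<close> is \<open>J\<close>, and the sum of the squares is affine and increasing in \<open>P\<close>. As the
  \<open>N\<^sub>y\<close> are integers, their mean square is at least \<open>J\<^sup>2 + \<eta> (1 - \<eta>)\<close>, the value attained when every
  \<open>N\<^sub>y\<close> is one of the two integers next to \<open>J\<close> (\<open>integer_second_moment\<close>). Solving for \<open>P\<close> gives the
  bound. The term \<open>n\<^sup>2\<close> in it is the contribution of \<open>y = 0\<close>.

  The only linear algebra behind the counts is \<open>|W| |W\<^sup>\<bottom>| = s^m\<close> (\<open>card_orth\<close>), applied to \<open>W\<close> and to
  the subspaces that arise by adjoining one or two columns to it.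
\<close>

section \<open>Subspaces over a finite field\<close>

lemma card_field_ge_two: "CARD('a::{finite,field}) \<ge> 2"
proof -
  have "card {0::'a, 1} \<le> CARD('a)" by (rule card_mono) auto
  then show ?thesis by simp
qed

abbreviation vec_subspace :: "nat \<Rightarrow> 'a::field vec set \<Rightarrow> bool" where
  "vec_subspace m W \<equiv> submodule class_ring W (module_vec TYPE('a) m)"

lemma vec_subspace_iff:
  fixes W :: "'a::field vec set"
  shows "vec_subspace m W \<longleftrightarrow>
    W \<subseteq> carrier_vec m \<and> 0\<^sub>v m \<in> W \<and> (\<forall>v\<in>W. \<forall>w\<in>W. v + w \<in> W) \<and> (\<forall>a. \<forall>v\<in>W. a \<cdot>\<^sub>v v \<in> W)"
  using vec_module[of m, where 'a='a]
  by (auto simp: submodule_def module_vec_simps class_ring_simps)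

lemma vec_subspaceD:
  fixes W :: "'a::field vec set"
  assumes "vec_subspace m W"
  shows vec_subspace_sub: "W \<subseteq> carrier_vec m"
    and vec_subspace_zero: "0\<^sub>v m \<in> W"
    and vec_subspace_add: "v \<in> W \<Longrightarrow> w \<in> W \<Longrightarrow> v + w \<in> W"
    and vec_subspace_smult: "v \<in> W \<Longrightarrow> a \<cdot>\<^sub>v v \<in> W"
  using assms by (auto simp: vec_subspace_iff)

lemma finite_vec_subspace:
  fixes W :: "'a::{finite,field} vec set"
  assumes "vec_subspace m W"
  shows "finite W"
  using assms card_carrier_vec_finite[of m, where 'a='a] finite_subset[of W "carrier_vec m"]
  by (auto simp: vec_subspace_iff)

lemma vec_subspace_diff:
  assumes "vec_subspace m W" "v \<in> W" "w \<in> W"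
  shows "v - w \<in> W"
proof -
  have c: "v \<in> carrier_vec m" "w \<in> carrier_vec m" using assms by (auto simp: vec_subspace_iff)
  then have "v - w = v + (-1) \<cdot>\<^sub>v w" by (intro eq_vecI) auto
  then show ?thesis using assms by (simp add: vec_subspace_iff)
qed

definition adjoin :: "'a::field vec set \<Rightarrow> 'a vec \<Rightarrow> 'a vec set" where
  "adjoin W t = (\<lambda>(a, w). w + a \<cdot>\<^sub>v t) ` (UNIV \<times> W)"

lemma adjoinI: "w \<in> W \<Longrightarrow> w + a \<cdot>\<^sub>v t \<in> adjoin W t"
  unfolding adjoin_def by (rule image_eqI[of _ _ "(a, w)"]) auto

lemma adjoin_iff:
  assumes "vec_subspace m W" "t \<in> carrier_vec m" "u \<in> carrier_vec m"
  shows "u \<in> adjoin W t \<longleftrightarrow> (\<exists>a. u - a \<cdot>\<^sub>v t \<in> W)"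
proof
  assume "u \<in> adjoin W t"
  then obtain a w where w: "w \<in> W" "u = w + a \<cdot>\<^sub>v t" by (auto simp: adjoin_def)
  then have "u - a \<cdot>\<^sub>v t = w" using assms by (intro eq_vecI) (auto simp: vec_subspace_iff)
  with w(1) show "\<exists>a. u - a \<cdot>\<^sub>v t \<in> W" by metis
next
  assume "\<exists>a. u - a \<cdot>\<^sub>v t \<in> W"
  then obtain a where "u - a \<cdot>\<^sub>v t \<in> W" ..
  moreover have "u = (u - a \<cdot>\<^sub>v t) + a \<cdot>\<^sub>v t" using assms by (intro eq_vecI) auto
  ultimately show "u \<in> adjoin W t" using adjoinI by metis
qed

lemma vec_subspace_adjoin:
  assumes W: "vec_subspace m W" and t: "t \<in> carrier_vec m"
  shows "vec_subspace m (adjoin W t)"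
  unfolding vec_subspace_iff
proof (intro conjI ballI allI)
  have Wc: "W \<subseteq> carrier_vec m" using W by (simp add: vec_subspace_iff)
  show sub: "adjoin W t \<subseteq> carrier_vec m" using Wc t by (auto simp: adjoin_def)
  have "0\<^sub>v m = 0\<^sub>v m + 0 \<cdot>\<^sub>v t" using t by (intro eq_vecI) auto
  then show "0\<^sub>v m \<in> adjoin W t" 
    using adjoinI[OF vec_subspace_zero[OF W]] by metis
  fix v assume "v \<in> adjoin W t"
  then obtain a x where v: "x \<in> W" "v = x + a \<cdot>\<^sub>v t" by (auto simp: adjoin_def)
  { fix c
    have "c \<cdot>\<^sub>v v = c \<cdot>\<^sub>v x + (c * a) \<cdot>\<^sub>v t" using v Wc t
      by (intro eq_vecI) (auto simp: algebra_simps)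
    then show "c \<cdot>\<^sub>v v \<in> adjoin W t" 
      using adjoinI[OF vec_subspace_smult[OF W v(1)]] by metis }
  fix w assume "w \<in> adjoin W t"
  then obtain b y where w: "y \<in> W" "w = y + b \<cdot>\<^sub>v t" by (auto simp: adjoin_def)
  have "v + w = (x + y) + (a + b) \<cdot>\<^sub>v t" using v w Wc t
    by (intro eq_vecI) (auto simp: algebra_simps)
  then show "v + w \<in> adjoin W t" 
    using adjoinI[OF vec_subspace_add[OF W v(1) w(1)]] by metis
qed

lemma adjoin_refl:
  assumes W: "vec_subspace m W" and t: "t \<in> carrier_vec m"
  shows "t \<in> adjoin W t"
proof -
  have "t - 1 \<cdot>\<^sub>v t = 0\<^sub>v m" using t by (intro eq_vecI) auto
  then show ?thesis using vec_subspace_zero[OF W] adjoin_iff[OF W t t] by metis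
qed

text \<open>
  Outside \<open>W\<close>, membership in \<open>adjoin W\<close> is proportionality of the images modulo \<open>W\<close>, which is an
  equivalence relation between vectors with nonzero images.
\<close>

lemma adjoin_sym:
  assumes W: "vec_subspace m W" and t: "t \<in> carrier_vec m" and u: "u \<in> carrier_vec m" "u \<notin> W"
    and ut: "u \<in> adjoin W t"
  shows "t \<in> adjoin W u"
proof -
  obtain a where a: "u - a \<cdot>\<^sub>v t \<in> W" using ut adjoin_iff[OF W t u(1)] by auto
  have "a \<noteq> 0"
  proof
    assume "a = 0"
    then have "u - a \<cdot>\<^sub>v t = u" using t u by (intro eq_vecI) auto
    then show False using a u by simp
  qed
  then have "t - inverse a \<cdot>\<^sub>v u = (- inverse a) \<cdot>\<^sub>v (u - a \<cdot>\<^sub>v t)"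
    using t u by (intro eq_vecI) (auto simp: field_simps)
  then show ?thesis using vec_subspace_smult[OF W a] adjoin_iff[OF W u(1) t] by metis
qed

lemma card_adjoin:
  fixes W :: "'a::{finite,field} vec set"
  assumes W: "vec_subspace m W" and t: "t \<in> carrier_vec m" "t \<notin> W"
  shows "card (adjoin W t) = CARD('a) * card W"
proof -
  have Wc: "W \<subseteq> carrier_vec m" using W by (simp add: vec_subspace_iff)
  have "inj_on (\<lambda>(a, w). w + a \<cdot>\<^sub>v t) (UNIV \<times> W)"
  proof (rule inj_onI, clarsimp)
    fix a v b w
    assume vw: "v \<in> W" "w \<in> W" and eq: "v + a \<cdot>\<^sub>v t = w + b \<cdot>\<^sub>v t"
    have idx: "v $ i + a * t $ i = w $ i + b * t $ i" if "i < m" for i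
      using arg_cong[OF eq, of "\<lambda>x. x $ i"] that vw Wc t(1) by auto
    have "a = b"
    proof (rule ccontr)
      assume "a \<noteq> b"
      have "t = inverse (a - b) \<cdot>\<^sub>v (w - v)"
      proof (rule eq_vecI)
        show "dim_vec t = dim_vec (inverse (a - b) \<cdot>\<^sub>v (w - v))" using vw Wc t(1) by auto
        fix i assume "i < dim_vec (inverse (a - b) \<cdot>\<^sub>v (w - v))"
        then have i: "i < m" using vw Wc by auto
        have "(a - b) * t $ i = w $ i - v $ i" using idx[OF i] by (simp add: algebra_simps)
        then have "t $ i = inverse (a - b) * (w $ i - v $ i)"
          using \<open>a \<noteq> b\<close> by (simp add: field_simps)
        then show "t $ i = (inverse (a - b) \<cdot>\<^sub>v (w - v)) $ i" using i vw Wc by auto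
      qed
      then show False
        using vec_subspace_smult[OF W vec_subspace_diff[OF W vw(2,1)]] t(2) by metis
    qed
    moreover have "v = w"
    proof (rule eq_vecI)
      show "dim_vec v = dim_vec w" using vw Wc by (metis carrier_vecD subsetD)
      show "v $ i = w $ i" if "i < dim_vec w" for i
        using that idx[of i] \<open>a = b\<close> vw Wc by auto
    qed
    ultimately show "a = b \<and> v = w" by simp
  qed
  then show ?thesis by (simp add: adjoin_def card_image card_cartesian_product)
qed

text \<open>
  The vectors of \<open>W\<close> orthogonal to \<open>y\<close> form the kernel of a nonzero functional, and adjoining any
  vector outside the kernel gives back all of \<open>W\<close>.
\<close>

lemma card_vec_subspace_hyperplane:
  fixes W :: "'a::{finite,field} vec set"
  assumes W: "vec_subspace m W" and y: "y \<in> carrier_vec m" and w0: "w0 \<in> W" "w0 \<bullet> y \<noteq> 0"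
  shows "CARD('a) * card {w\<in>W. w \<bullet> y = 0} = card W"
proof -
  let ?K = "{w\<in>W. w \<bullet> y = 0}"
  have Wc: "W \<subseteq> carrier_vec m" using W by (simp add: vec_subspace_iff)
  have K: "vec_subspace m ?K"
    unfolding vec_subspace_iff
  proof (intro conjI ballI allI)
    show "?K \<subseteq> carrier_vec m" using Wc by auto
    show "0\<^sub>v m \<in> ?K" using vec_subspace_zero[OF W] y by simp
    fix v assume v: "v \<in> ?K"
    then have vc: "v \<in> carrier_vec m" using Wc by auto
    show "a \<cdot>\<^sub>v v \<in> ?K" for a using v vc y vec_subspace_smult[OF W] by simp
    fix w assume w: "w \<in> ?K"
    then have "w \<in> carrier_vec m" using Wc by auto
    then show "v + w \<in> ?K"
      using v w vc y vec_subspace_add[OF W] by (simp add: add_scalar_prod_distrib)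
  qed
  have w0c: "w0 \<in> carrier_vec m" using w0 Wc by auto
  have "adjoin ?K w0 = W"
  proof
    show "adjoin ?K w0 \<subseteq> W" using W w0 by (auto simp: adjoin_def vec_subspace_iff)
    show "W \<subseteq> adjoin ?K w0"
    proof
      fix w assume w: "w \<in> W"
      then have wc: "w \<in> carrier_vec m" using Wc by auto
      let ?a = "(w \<bullet> y) / (w0 \<bullet> y)"
      have "(w - ?a \<cdot>\<^sub>v w0) \<bullet> y = 0"
        using w0c wc y w0(2) by (simp add: minus_scalar_prod_distrib[of _ m])
      moreover have "w - ?a \<cdot>\<^sub>v w0 \<in> W"
        using W w w0 by (intro vec_subspace_diff[OF W]) (auto simp: vec_subspace_iff)
      ultimately show "w \<in> adjoin ?K w0" unfolding adjoin_iff[OF K w0c wc] by blast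
    qed
  qed
  then show ?thesis using card_adjoin[OF K w0c] w0 by simp
qed

section \<open>Orthogonal complements\<close>

definition orth :: "nat \<Rightarrow> 'a::field vec set \<Rightarrow> 'a vec set" where
  "orth m W = {y \<in> carrier_vec m. \<forall>w\<in>W. w \<bullet> y = 0}"

lemma vec_subspace_carrier: "vec_subspace m (carrier_vec m)"
  by (auto simp: vec_subspace_iff)

text \<open>
  Count the orthogonal pairs in \<open>W \<times> V\<close> both ways, where \<open>V\<close> is the whole space. In either direction
  a fibre is everything or an \<open>s\<close>-th part of it: everything for \<open>w = 0\<close>, respectively for
  \<open>y \<in> orth m W\<close>. Comparison of the two counts gives
  \<open>(s - 1) |V| = (s - 1) |W| |orth m W|\<close>.
\<close>

lemma card_orth:
  fixes W :: "'a::{finite,field} vec set"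
  assumes W: "vec_subspace m W"
  shows "card W * card (orth m W) = CARD('a) ^ m"
proof -
  let ?V = "carrier_vec m :: 'a vec set"
  let ?s = "CARD('a)"
  let ?Y = "orth m W"
  have Wc: "W \<subseteq> ?V" and W0: "0\<^sub>v m \<in> W" using W by (auto simp: vec_subspace_iff)
  have finV: "finite ?V" and cV: "card ?V = ?s ^ m" using card_carrier_vec_finite by auto
  have finW: "finite W" using finite_vec_subspace[OF W] .
  have fibre_w: "?s * card {y\<in>?V. w \<bullet> y = 0} = (if w = 0\<^sub>v m then ?s * card ?V else card ?V)"
    if "w \<in> W" for w
  proof (cases "w = 0\<^sub>v m")
    case True
    then have "{y\<in>?V. w \<bullet> y = 0} = ?V" by auto
    then show ?thesis using True by simp
  next
    case False
    have wc: "w \<in> ?V" using that Wc by auto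
    with False obtain i where i: "i < m" "w $ i \<noteq> 0"
      by (metis carrier_vecD eq_vecI index_zero_vec)
    then have "unit_vec m i \<bullet> w \<noteq> 0" using wc by simp
    from card_vec_subspace_hyperplane[OF vec_subspace_carrier wc unit_vec_carrier this]
    have "?s * card {y\<in>?V. y \<bullet> w = 0} = card ?V" .
    moreover have "{y\<in>?V. y \<bullet> w = 0} = {y\<in>?V. w \<bullet> y = 0}"
      using comm_scalar_prod[OF wc] by auto
    ultimately show ?thesis using False by simp
  qed
  have fibre_y: "?s * card {w\<in>W. w \<bullet> y = 0} = (if y \<in> ?Y then ?s * card W else card W)"
    if y: "y \<in> ?V" for y
  proof (cases "y \<in> ?Y")
    case True
    then have "{w\<in>W. w \<bullet> y = 0} = W" by (auto simp: orth_def)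
    then show ?thesis using True by simp
  next
    case False
    then obtain w0 where "w0 \<in> W" "w0 \<bullet> y \<noteq> 0" using y by (auto simp: orth_def)
    then show ?thesis using card_vec_subspace_hyperplane[OF W y] False by simp
  qed
  have "(\<Sum>w\<in>W. card {y\<in>?V. w \<bullet> y = 0}) = (\<Sum>y\<in>?V. card {w\<in>W. w \<bullet> y = 0})"
    by (rule sum_multicount_gen) (use finW finV in auto)
  then have "(\<Sum>w\<in>W. ?s * card {y\<in>?V. w \<bullet> y = 0}) = (\<Sum>y\<in>?V. ?s * card {w\<in>W. w \<bullet> y = 0})"
    by (simp flip: sum_distrib_left)
  moreover have "(\<Sum>w\<in>W. ?s * card {y\<in>?V. w \<bullet> y = 0}) = ?s * card ?V + (card W - 1) * card ?V"
  proof -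
    have "(\<Sum>w\<in>W - {0\<^sub>v m}. ?s * card {y\<in>?V. w \<bullet> y = 0}) = (\<Sum>w\<in>W - {0\<^sub>v m}. card ?V)"
      by (intro sum.cong) (simp_all add: fibre_w)
    then show ?thesis
      using fibre_w[OF W0] by (simp add: sum.remove[OF finW W0] card_Diff_singleton[OF W0])
  qed
  moreover have "(\<Sum>y\<in>?V. ?s * card {w\<in>W. w \<bullet> y = 0})
      = card ?Y * (?s * card W) + (card ?V - card ?Y) * card W"
  proof -
    have sub: "?Y \<subseteq> ?V" by (auto simp: orth_def)
    have "(\<Sum>y\<in>?V. ?s * card {w\<in>W. w \<bullet> y = 0}) = (\<Sum>y\<in>?V. if y \<in> ?Y then ?s * card W else card W)"
      by (intro sum.cong) (simp_all add: fibre_y)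
    also have "\<dots> = (\<Sum>y\<in>?V \<inter> ?Y. ?s * card W) + (\<Sum>y\<in>?V \<inter> - ?Y. card W)"
      using finV by (subst sum.If_cases) auto
    also have "?V \<inter> ?Y = ?Y" using sub by auto
    also have "?V \<inter> - ?Y = ?V - ?Y" by auto
    finally show ?thesis using sub finV by (simp add: card_Diff_subset finite_subset)
  qed
  ultimately have eq: "?s * card ?V + (card W - 1) * card ?V
      = card ?Y * (?s * card W) + (card ?V - card ?Y) * card W" by simp
  have "card ?Y \<le> card ?V" using finV by (intro card_mono) (auto simp: orth_def)
  moreover have "card W \<ge> 1" using W0 finW by (metis One_nat_def Suc_leI card_gt_0_iff empty_iff)
  ultimately obtain d e where "card ?V = card ?Y + d" "card W = Suc e"
    by (metis Suc_le_D One_nat_def le_Suc_ex)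
  then have "(real ?s - 1) * real (card ?V) = (real ?s - 1) * (real (card W) * real (card ?Y))"
    using arg_cong[OF eq, of real] by (simp add: algebra_simps)
  moreover have "real ?s - 1 \<noteq> 0" using card_field_ge_two[where 'a='a] by simp
  ultimately have "real (card W) * real (card ?Y) = real (card ?V)" by simp
  then have "real (card W * card ?Y) = real (?s ^ m)" using cV by simp
  then show ?thesis by (simp only: of_nat_eq_iff)
qed

lemma orth_adjoin:
  assumes W: "vec_subspace m W" and t: "t \<in> carrier_vec m"
  shows "orth m (adjoin W t) = {y \<in> orth m W. t \<bullet> y = 0}"
proof
  have Wc: "W \<subseteq> carrier_vec m" using W by (auto simp: vec_subspace_iff)
  show "{y \<in> orth m W. t \<bullet> y = 0} \<subseteq> orth m (adjoin W t)"
    using Wc t by (auto simp: orth_def adjoin_def add_scalar_prod_distrib[of _ m] subset_iff)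
  have "w \<in> adjoin W t" if "w \<in> W" for w
  proof -
    have "w - 0 \<cdot>\<^sub>v t = w" using that Wc t by (intro eq_vecI) auto
    then show ?thesis using that Wc adjoin_iff[OF W t, of w] by (metis subsetD)
  qed
  moreover have "t \<in> adjoin W t" by (rule adjoin_refl[OF W t])
  ultimately show "orth m (adjoin W t) \<subseteq> {y \<in> orth m W. t \<bullet> y = 0}"
    by (auto simp: orth_def)
qed

lemma card_orth_hyperplane:
  fixes W :: "'a::{finite,field} vec set"
  assumes W: "vec_subspace m W" and t: "t \<in> carrier_vec m" "t \<notin> W"
  shows "CARD('a) * card W * card {y \<in> orth m W. t \<bullet> y = 0} = CARD('a) ^ m"
  using card_orth[OF vec_subspace_adjoin[OF W t(1)]] orth_adjoin[OF W t(1)] card_adjoin[OF W t]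
  by simp

lemma card_orth_two_hyperplanes:
  fixes W :: "'a::{finite,field} vec set"
  assumes W: "vec_subspace m W" and t: "t \<in> carrier_vec m" "t \<notin> W" and u: "u \<in> carrier_vec m"
  shows "CARD('a) ^ 2 * card W * card {y \<in> orth m W. t \<bullet> y = 0 \<and> u \<bullet> y = 0}
    = CARD('a) ^ m * (if u \<in> adjoin W t then CARD('a) else 1)"
proof -
  have W': "vec_subspace m (adjoin W t)" using W t(1) by (rule vec_subspace_adjoin)
  have eq: "{y \<in> orth m W. t \<bullet> y = 0 \<and> u \<bullet> y = 0} = {y \<in> orth m (adjoin W t). u \<bullet> y = 0}"
    unfolding orth_adjoin[OF W t(1)] by auto
  show ?thesis
  proof (cases "u \<in> adjoin W t")
    case True
    then have "{y \<in> orth m (adjoin W t). u \<bullet> y = 0} = orth m (adjoin W t)"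
      by (auto simp: orth_def)
    then show ?thesis
      using card_orth[OF W'] True unfolding eq card_adjoin[OF W t] by (simp add: power2_eq_square)
  next
    case False
    then show ?thesis
      using card_orth_hyperplane[OF W' u False] unfolding eq card_adjoin[OF W t]
      by (simp add: power2_eq_square mult.assoc)
  qed
qed

section \<open>Second moments\<close>

text \<open>
  No integer lies strictly between \<open>\<lfloor>J\<rfloor>\<close> and \<open>\<lfloor>J\<rfloor> + 1\<close>, so
  \<open>(f x - \<lfloor>J\<rfloor>) (f x - \<lfloor>J\<rfloor> - 1) \<ge> 0\<close> for every \<open>x\<close>; this is summed over \<open>M\<close>. For real-valued \<open>f\<close>
  only the bound \<open>J\<^sup>2\<close> would hold.
\<close>

lemma integer_second_moment:
  fixes f :: "'b \<Rightarrow> int" and J :: real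
  assumes mean: "(\<Sum>x\<in>M. real_of_int (f x)) = real (card M) * J"
  shows "real (card M) * (J\<^sup>2 + frac J * (1 - frac J)) \<le> (\<Sum>x\<in>M. (real_of_int (f x))\<^sup>2)"
proof -
  define k where "k = real_of_int \<lfloor>J\<rfloor>"
  define h where "h = frac J"
  have J: "J = k + h" by (simp add: k_def h_def frac_def)
  have "0 \<le> (real_of_int (f x) - k) * (real_of_int (f x) - k - 1)" for x
  proof -
    have "0 \<le> (f x - \<lfloor>J\<rfloor>) * (f x - \<lfloor>J\<rfloor> - 1)"
      by (cases "f x \<le> \<lfloor>J\<rfloor>") (auto intro: mult_nonpos_nonpos mult_nonneg_nonneg)
    then have "0 \<le> real_of_int ((f x - \<lfloor>J\<rfloor>) * (f x - \<lfloor>J\<rfloor> - 1))" by (simp only: of_int_0_le_iff)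
    then show ?thesis by (simp add: k_def)
  qed
  then have "0 \<le> (\<Sum>x\<in>M. (real_of_int (f x) - k) * (real_of_int (f x) - k - 1))"
    by (intro sum_nonneg) auto
  also have "\<dots> = (\<Sum>x\<in>M. (real_of_int (f x))\<^sup>2 - (2 * k + 1) * real_of_int (f x) + k * (k + 1))"
    by (intro sum.cong) (auto simp: algebra_simps power2_eq_square)
  also have "\<dots> = (\<Sum>x\<in>M. (real_of_int (f x))\<^sup>2) - (2 * k + 1) * (real (card M) * J)
      + real (card M) * (k * (k + 1))"
    by (simp add: sum.distrib sum_subtractf sum_distrib_left[symmetric] mean)
  also have "\<dots> = (\<Sum>x\<in>M. (real_of_int (f x))\<^sup>2) - real (card M) * ((2 * k + 1) * J - k * (k + 1))"
    by (simp add: algebra_simps)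
  also have "(2 * k + 1) * J - k * (k + 1) = J\<^sup>2 + frac J * (1 - frac J)"
    unfolding h_def[symmetric] by (simp only: J) (simp add: algebra_simps power2_eq_square)
  finally show ?thesis by simp
qed

section \<open>Vectors on hyperplanes containing a subspace\<close>

lemma card_symmetric_relation:
  fixes P :: "nat \<Rightarrow> nat \<Rightarrow> bool"
  assumes refl: "\<And>i. i < n \<Longrightarrow> P i i"
    and sym: "\<And>i j. i < n \<Longrightarrow> j < n \<Longrightarrow> P i j \<Longrightarrow> P j i"
  shows "card {(i, j). i < n \<and> j < n \<and> P i j} = n + 2 * card {(i, j). i < j \<and> j < n \<and> P i j}"
proof -
  let ?D = "(\<lambda>i. (i, i)) ` {..<n}" and ?U = "{(i, j). i < j \<and> j < n \<and> P i j}"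
  have finU: "finite ?U" by (rule finite_subset[of _ "{..<n} \<times> {..<n}"]) auto
  have split: "{(i, j). i < n \<and> j < n \<and> P i j} = ?D \<union> (?U \<union> prod.swap ` ?U)"
  proof (rule subset_antisym; rule subsetI)
    fix x assume "x \<in> {(i, j). i < n \<and> j < n \<and> P i j}"
    then obtain i j where x: "x = (i, j)" and ij: "i < n" "j < n" "P i j" by auto
    consider "i = j" | "i < j" | "j < i" by linarith
    then show "x \<in> ?D \<union> (?U \<union> prod.swap ` ?U)"
    proof cases
      case 3
      then have "(j, i) \<in> ?U" using ij sym[OF ij] by simp
      then have "prod.swap (j, i) \<in> prod.swap ` ?U" by (rule imageI)
      then show ?thesis using x by simp
    qed (use x ij in auto)
  next
    fix x assume "x \<in> ?D \<union> (?U \<union> prod.swap ` ?U)"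
    then consider i where "x = (i, i)" "i < n"
      | i j where "x = (i, j)" "i < j" "j < n" "P i j" | i j where "x = (j, i)" "i < j" "j < n" "P i j"
      by auto
    then show "x \<in> {(i, j). i < n \<and> j < n \<and> P i j}"
    proof cases
      case (3 i j)
      then show ?thesis using sym[of i j] by simp
    qed (simp_all add: refl)
  qed
  have "card (?D \<union> (?U \<union> prod.swap ` ?U)) = card ?D + (card ?U + card (prod.swap ` ?U))"
    using finU by (subst card_Un_disjoint; (subst card_Un_disjoint)?) auto
  also have "card ?D = n" by (subst card_image) (auto simp: inj_on_def)
  also have "card (prod.swap ` ?U) = card ?U" by (intro card_image) auto
  finally show ?thesis unfolding split by simp
qed

text \<open>
  \<open>N y\<close> counts the vectors \<open>t i\<close> on the hyperplane orthogonal to \<open>y\<close>, so that \<open>N y\<close> and its square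
  count single indices and ordered pairs of indices annihilated by \<open>y\<close>; interchanging the sums
  reduces both moments to the sizes of orthogonal complements. The relation \<open>R\<close> contains the
  diagonal. Factors of \<open>s\<close> and \<open>card W\<close> are multiplied out to stay in the natural numbers.
\<close>

lemma hyperplane_moments:
  fixes W :: "'a::{finite,field} vec set" and t :: "nat \<Rightarrow> 'a vec"
  assumes W: "vec_subspace m W" and t: "\<And>i. i < n \<Longrightarrow> t i \<in> carrier_vec m - W"
  defines "N \<equiv> \<lambda>y. card {i. i < n \<and> t i \<bullet> y = 0}"
    and "R \<equiv> {(i, j). i < n \<and> j < n \<and> t j \<in> adjoin W (t i)}"
  shows "CARD('a) * card W * (\<Sum>y\<in>orth m W. N y) = CARD('a) ^ m * n" (is ?first)
    and "CARD('a)\<^sup>2 * card W * (\<Sum>y\<in>orth m W. (N y)\<^sup>2)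
           = CARD('a) ^ m * (n\<^sup>2 + (CARD('a) - 1) * card R)" (is ?second)
proof -
  let ?Y = "orth m W" and ?s = "CARD('a)"
  have finY: "finite ?Y"
    using card_carrier_vec_finite[of m, where 'a='a] by (auto simp: orth_def)
  have "(\<Sum>y\<in>?Y. N y) = (\<Sum>i\<in>{..<n}. card {y\<in>?Y. t i \<bullet> y = 0})"
    using sum_multicount_gen[of ?Y "{..<n}" "\<lambda>y i. t i \<bullet> y = 0"] finY by (simp add: N_def)
  then have "?s * card W * (\<Sum>y\<in>?Y. N y) = (\<Sum>i\<in>{..<n}. ?s * card W * card {y\<in>?Y. t i \<bullet> y = 0})"
    by (simp add: sum_distrib_left)
  also have "\<dots> = (\<Sum>i\<in>{..<n}. ?s ^ m)"
    using t by (intro sum.cong refl card_orth_hyperplane[OF W]) auto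
  finally show ?first by simp
  let ?P = "{..<n} \<times> {..<n}"
  have sq: "(N y)\<^sup>2 = card {x\<in>?P. t (fst x) \<bullet> y = 0 \<and> t (snd x) \<bullet> y = 0}" for y
  proof -
    have "{x\<in>?P. t (fst x) \<bullet> y = 0 \<and> t (snd x) \<bullet> y = 0}
        = {i. i < n \<and> t i \<bullet> y = 0} \<times> {i. i < n \<and> t i \<bullet> y = 0}" by auto
    then show ?thesis by (simp add: N_def card_cartesian_product power2_eq_square)
  qed
  have "(\<Sum>y\<in>?Y. (N y)\<^sup>2) = (\<Sum>x\<in>?P. card {y\<in>?Y. t (fst x) \<bullet> y = 0 \<and> t (snd x) \<bullet> y = 0})"
    unfolding sq using finY by (intro sum_multicount_gen) auto
  then have "?s\<^sup>2 * card W * (\<Sum>y\<in>?Y. (N y)\<^sup>2)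
      = (\<Sum>x\<in>?P. ?s\<^sup>2 * card W * card {y\<in>?Y. t (fst x) \<bullet> y = 0 \<and> t (snd x) \<bullet> y = 0})"
    by (simp add: sum_distrib_left)
  also have "\<dots> = (\<Sum>x\<in>?P. ?s ^ m * (if t (snd x) \<in> adjoin W (t (fst x)) then ?s else 1))"
    using t by (intro sum.cong refl card_orth_two_hyperplanes[OF W]) auto
  also have "\<dots> = ?s ^ m * (\<Sum>x\<in>?P. 1 + (if x \<in> R then ?s - 1 else 0))"
    unfolding sum_distrib_left
    using card_field_ge_two[where 'a='a]
    by (intro sum.cong refl) (auto simp: R_def simp flip: mult_Suc_right)
  also have "(\<Sum>x\<in>?P. 1 + (if x \<in> R then ?s - 1 else 0)) = n\<^sup>2 + (?s - 1) * card R"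
  proof -
    have "?P \<inter> R = R" by (auto simp: R_def)
    then show ?thesis 
      unfolding sum.distrib by (simp add: sum.If_cases card_cartesian_product power2_eq_square)
  qed
  finally show ?second .
qed

text \<open>
  The core inequality, free of designs. The zero functional annihilates all \<open>n\<close> vectors and is
  therefore split off before the integrality argument: over the other \<open>q - 1\<close> functionals the mean of
  \<open>N\<close> is \<open>J\<close>, while including it would give mean \<open>n / s\<close> and discard the
  known value \<open>N 0 = n\<close>.
\<close>

lemma equivalent_pairs_bound:
  fixes W :: "'a::{finite,field} vec set" and t :: "nat \<Rightarrow> 'a vec" and n :: nat and J s q :: real
  assumes W: "vec_subspace m W" and t: "\<And>i. i < n \<Longrightarrow> t i \<in> carrier_vec m - W"
  defines "s \<equiv> real CARD('a)" and "q \<equiv> real (card (orth m W))"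
    and "P \<equiv> card {(i, j). i < j \<and> j < n \<and> t j \<in> adjoin W (t i)}"
  assumes q1: "q > 1" and J: "J = n * (q / s - 1) / (q - 1)"
  shows "n\<^sup>2 + (q - 1) * (J\<^sup>2 + frac J * (1 - frac J)) \<le> q / s\<^sup>2 * (n * (n + s - 1) + 2 * (s - 1) * P)"
proof -
  define N where "N = (\<lambda>y. card {i. i < n \<and> t i \<bullet> y = 0})"
  let ?Y = "orth m W" and ?z = "0\<^sub>v m :: 'a vec"
  define R where "R = {(i, j). i < n \<and> j < n \<and> t j \<in> adjoin W (t i)}"
  have R: "card R = n + 2 * P" unfolding R_def P_def
    using t by (intro card_symmetric_relation) (auto intro: adjoin_refl[OF W] adjoin_sym[OF W])
  have Wc: "W \<subseteq> carrier_vec m" by (rule vec_subspace_sub[OF W])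
  have s: "s > 1" using card_field_ge_two[where 'a='a] by (simp add: s_def)
  have finY: "finite ?Y"
    using card_carrier_vec_finite[of m, where 'a='a] by (auto simp: orth_def)
  have zY: "?z \<in> ?Y" using Wc by (auto simp: orth_def)
  have "card W \<noteq> 0" using finite_vec_subspace[OF W] vec_subspace_zero[OF W] by auto
  then have w: "real (card W) > 0" by simp
  have Vq: "s ^ m = card W * q"
    using arg_cong[OF card_orth[OF W], of real] by (simp add: s_def q_def)
  have "s * card W * (\<Sum>y\<in>?Y. real (N y)) = card W * q * n"
    using arg_cong[OF hyperplane_moments(1)[where t = t and n = n, OF W t], where f = real]
    by (simp add: N_def Vq[symmetric]) (simp add: s_def)
  then have "s * (\<Sum>y\<in>?Y. real (N y)) = q * n"
    using w by (simp add: mult.assoc mult.left_commute[of _ "real (card W)"])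
  then have first: "(\<Sum>y\<in>?Y. real (N y)) = q * n / s" using s by (simp add: field_simps)
  have "s\<^sup>2 * card W * (\<Sum>y\<in>?Y. (real (N y))\<^sup>2) = card W * q * (n\<^sup>2 + (s - 1) * card R)"
    using arg_cong[OF hyperplane_moments(2)[where t = t and n = n, OF W t], where f = real]
      card_field_ge_two[where 'a='a]
    by (simp add: N_def R_def Vq[symmetric] of_nat_diff) (simp add: s_def)
  then have "s\<^sup>2 * (\<Sum>y\<in>?Y. (real (N y))\<^sup>2) = q * (n\<^sup>2 + (s - 1) * card R)"
    using w by (simp add: mult.assoc mult.left_commute[of _ "real (card W)"])
  then have second: "(\<Sum>y\<in>?Y. (real (N y))\<^sup>2) = q / s\<^sup>2 * (n\<^sup>2 + (s - 1) * card R)"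
    using s by (simp add: field_simps)
  have Nz: "N ?z = n"
  proof -
    have "{i. i < n \<and> t i \<bullet> ?z = 0} = {..<n}" using t by auto
    then show ?thesis by (simp add: N_def)
  qed
  have c: "real (card (?Y - {?z})) = q - 1"
    using zY finY q1 by (simp add: q_def card_Diff_singleton of_nat_diff)
  have "(\<Sum>y\<in>?Y - {?z}. real (N y)) = n * (q / s - 1)"
    using first sum.remove[OF finY zY, of "\<lambda>y. real (N y)"] Nz by (simp add: algebra_simps)
  then have "(\<Sum>y\<in>?Y - {?z}. real_of_int (int (N y))) = real (card (?Y - {?z})) * J"
    using q1 unfolding c J by simp
  from integer_second_moment[OF this]
  have "(q - 1) * (J\<^sup>2 + frac J * (1 - frac J)) \<le> (\<Sum>y\<in>?Y - {?z}. (real (N y))\<^sup>2)"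
    unfolding c by simp
  then have "n\<^sup>2 + (q - 1) * (J\<^sup>2 + frac J * (1 - frac J)) \<le> (\<Sum>y\<in>?Y. (real (N y))\<^sup>2)"
    using sum.remove[OF finY zY, of "\<lambda>y. (real (N y))\<^sup>2"] Nz by simp
  also have "\<dots> = q / s\<^sup>2 * (n * (n + s - 1) + 2 * (s - 1) * P)"
    unfolding second R by (simp add: algebra_simps power2_eq_square)
  finally show ?thesis .
qed

section \<open>Words confounded with block effects\<close>

lemma full_column_rank_inj:
  fixes B :: "'a::field mat"
  assumes B: "B \<in> carrier_mat m p" and rank: "vec_space.rank m B = p"
  shows "inj_on (\<lambda>l. B *\<^sub>v l) (carrier_vec p)"
proof -
  interpret vec_space "TYPE('a)" m .
  \<comment> \<open>A repeated column would leave fewer than \<open>p\<close> distinct ones, too few for rank \<open>p\<close>.\<close>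
  have dist: "distinct (cols B)"
  proof -
    have "set (cols B) \<subseteq> carrier_vec m" using B cols_dim by blast
    obtain S where S: "finite S" "maximal S (\<lambda>U. U \<subseteq> set (cols B) \<and> lin_indpt U)"
      using maximal_exists_superset[of "set (cols B)" "\<lambda>U. U \<subseteq> set (cols B) \<and> lin_indpt U" "{}"]
      using finite_lin_indpt2[of "{}"] by auto
    then have "S \<subseteq> set (cols B)" by (auto simp: maximal_def)
    then have "p \<le> card (set (cols B))"
      using rank_card_indpt[OF B S(2)] rank by (metis List.finite_set card_mono)
    moreover have "length (cols B) = p" using B by simp
    ultimately show ?thesis by (metis card_distinct card_length le_antisym)
  qed
  have indpt: "lin_indpt (set (cols B))" using B rank dist by (rule full_rank_lin_indpt)
  show ?thesis
  proof (rule inj_onI)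
    fix k l :: "'a vec" assume k: "k \<in> carrier_vec p" and l: "l \<in> carrier_vec p"
      and eq: "B *\<^sub>v k = B *\<^sub>v l"
    have "B *\<^sub>v (k - l) = 0\<^sub>v m"
      using B k l eq by (simp add: mult_minus_distrib_mat_vec[OF B k l])
    then have "k - l = 0\<^sub>v p"
      using lin_depI[OF B _ _ _ dist, of "k - l"] indpt k l by auto
    then show "k = l" using k l
      by (metis carrier_vecD eq_vecI index_minus_vec(1) index_zero_vec(1) right_minus_eq)
  qed
qed

lemma vec_subspace_range:
  fixes B :: "'a::field mat"
  assumes B: "B \<in> carrier_mat m p"
  shows "vec_subspace m ((\<lambda>l. B *\<^sub>v l) ` carrier_vec p)"
  unfolding vec_subspace_iff
proof (intro conjI ballI allI)
  show "(\<lambda>l. B *\<^sub>v l) ` carrier_vec p \<subseteq> carrier_vec m" using B by auto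
  have "B *\<^sub>v 0\<^sub>v p = 0\<^sub>v m" using B by (intro eq_vecI) auto
  then show "0\<^sub>v m \<in> (\<lambda>l. B *\<^sub>v l) ` carrier_vec p" by (metis imageI zero_carrier_vec)
  fix v assume "v \<in> (\<lambda>l. B *\<^sub>v l) ` carrier_vec p"
  then obtain k where k: "v = B *\<^sub>v k" "k \<in> carrier_vec p" by auto
  show "a \<cdot>\<^sub>v v \<in> (\<lambda>l. B *\<^sub>v l) ` carrier_vec p" for a
    using k by (metis B imageI mult_mat_vec smult_carrier_vec)
  fix w assume "w \<in> (\<lambda>l. B *\<^sub>v l) ` carrier_vec p"
  then obtain l where l: "w = B *\<^sub>v l" "l \<in> carrier_vec p" by auto
  show "v + w \<in> (\<lambda>l. B *\<^sub>v l) ` carrier_vec p"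
    using k l by (metis B add_carrier_vec imageI mult_add_distrib_mat_vec)
qed

lemma normalize_vec:
  fixes l :: "'a::field vec"
  assumes l: "l \<in> carrier_vec p" "l \<noteq> 0\<^sub>v p"
  obtains c l' where "c \<noteq> 0" "l' \<in> normalized_vecs p" "l = c \<cdot>\<^sub>v l'"
proof -
  let ?P = "\<lambda>i. i < p \<and> l $ i \<noteq> 0"
  obtain i0 where "?P i0" using l by (metis carrier_vecD eq_vecI index_zero_vec)
  then have i: "?P (LEAST i. ?P i)" by (rule LeastI)
  define i where "i = (LEAST i. ?P i)"
  have below: "l $ j = 0" if "j < i" for j
    using not_less_Least[of j ?P] that i by (auto simp: i_def)
  have i': "i < p" "l $ i \<noteq> 0" using i by (auto simp: i_def)
  let ?l = "inverse (l $ i) \<cdot>\<^sub>v l"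
  have "?l \<in> normalized_vecs p" unfolding normalized_vecs_def
    using l i' below by (auto intro!: exI[of _ i])
  moreover have "l = l $ i \<cdot>\<^sub>v ?l" using i' by (intro eq_vecI) auto
  ultimately show ?thesis using i' that by blast
qed

lemma hamming_weight_smult_unit:
  assumes "i < n" "c \<noteq> 0"
  shows "hamming_weight (c \<cdot>\<^sub>v unit_vec n i :: 'a::field vec) = 1"
proof -
  have "{j. j < dim_vec (c \<cdot>\<^sub>v unit_vec n i) \<and> (c \<cdot>\<^sub>v unit_vec n i) $ j \<noteq> (0::'a)} = {i}"
    using assms by (auto simp: unit_vec_def split: if_splits)
  then show ?thesis by (simp add: hamming_weight_def)
qed

lemma mult_mat_smult_unit_vec:
  fixes A :: "'a::field mat"
  assumes "A \<in> carrier_mat m n" "i < n"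
  shows "A *\<^sub>v (c \<cdot>\<^sub>v unit_vec n i) = c \<cdot>\<^sub>v col A i"
  using assms by (intro eq_vecI) (auto simp: scalar_prod_right_unit)

text \<open>
  Up to a scalar the columns of the confounding matrix are all the nonzero vectors in the column space
  of \<open>B\<close>, hence every such vector is the image of a block word of weight 1.
\<close>

lemma confounded_with_block:
  fixes B :: "'a::{finite,field} mat"
  assumes l: "l \<in> carrier_vec (dim_col B)" "B *\<^sub>v l \<noteq> 0\<^sub>v (dim_row B)"
  obtains w where "w \<in> carrier_vec (L CARD('a) (dim_col B))" "hamming_weight w = 1"
    "confounding_matrix B *\<^sub>v w = B *\<^sub>v l"
proof -
  let ?L = "L CARD('a) (dim_col B)" and ?F = "confounding_matrix B"
  note F = confounding_matrix_props(1)[of B]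
  have B: "B \<in> carrier_mat (dim_row B) (dim_col B)" by simp
  obtain e where e: "bij_betw e {..<?L} (normalized_vecs (dim_col B))"
    "\<forall>j<?L. col ?F j = B *\<^sub>v e j"
    using confounding_matrix_props(2)[of B] by auto
  have "l \<noteq> 0\<^sub>v (dim_col B)" using l(2) by (auto intro!: eq_vecI)
  then obtain c l' where c: "c \<noteq> 0" "l' \<in> normalized_vecs (dim_col B)" "l = c \<cdot>\<^sub>v l'"
    using l normalize_vec by metis
  then obtain j where j: "j < ?L" "e j = l'"
    using e(1) by (metis bij_betw_imp_surj_on imageE lessThan_iff)
  have l': "l' \<in> carrier_vec (dim_col B)" using c by (simp add: normalized_vecs_def)
  have "?F *\<^sub>v (c \<cdot>\<^sub>v unit_vec ?L j) = c \<cdot>\<^sub>v (B *\<^sub>v l')"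
    using mult_mat_smult_unit_vec[OF F j(1)] e(2) j by simp
  also have "\<dots> = B *\<^sub>v l" using mult_mat_vec[OF B l'] c(3) by simp
  finally show ?thesis
    using hamming_weight_smult_unit[OF j(1) c(1)] by (intro that[of "c \<cdot>\<^sub>v unit_vec ?L j"]) auto
qed

lemma A0_eq_0_D:
  fixes T :: "'a::{finite,field} mat"
  assumes "A0 T i = 0" "w \<in> carrier_vec (dim_col T)" "hamming_weight w = i"
  shows "T *\<^sub>v w \<noteq> 0\<^sub>v (dim_row T)"
proof
  assume "T *\<^sub>v w = 0\<^sub>v (dim_row T)"
  let ?S = "{w \<in> carrier_vec (dim_col T). T *\<^sub>v w = 0\<^sub>v (dim_row T) \<and> hamming_weight w = i}"
  have "finite ?S" using card_carrier_vec_finite[of "dim_col T", where 'a='a] by auto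
  moreover have "w \<in> ?S" using assms \<open>T *\<^sub>v w = _\<close> by simp
  ultimately have "card ?S \<noteq> 0" by auto
  then show False using assms(1) card_field_ge_two[where 'a='a] by (simp add: A0_def)
qed

definition confounded_words :: "'a::{finite,field} mat \<Rightarrow> 'a mat \<Rightarrow> nat \<Rightarrow> ('a vec \<times> 'a vec) set" where
  "confounded_words T B i = {(w1, w2). w1 \<in> carrier_vec (dim_col T) \<and>
     w2 \<in> carrier_vec (L CARD('a) (dim_col B)) \<and>
     T *\<^sub>v w1 + confounding_matrix B *\<^sub>v w2 = 0\<^sub>v (dim_row T) \<and>
     hamming_weight w1 = i \<and> hamming_weight w2 = 1}"

lemma A1_eq: "A1 T B i = real (card (confounded_words T B i)) / (real CARD('a) - 1)"
  for T :: "'a::{finite,field} mat"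
  by (simp add: A1_def confounded_words_def)

lemma finite_confounded_words: "finite (confounded_words T B i)"
  for T :: "'a::{finite,field} mat"
proof (rule finite_subset)
  show "confounded_words T B i
    \<subseteq> carrier_vec (dim_col T) \<times> carrier_vec (L CARD('a) (dim_col B))"
    by (auto simp: confounded_words_def)
qed (use card_carrier_vec_finite[where 'a='a] in blast)

text \<open>
  Treatment words whose image is a nonzero vector in the column space of \<open>B\<close> are confounded with block
  effects. The nonvanishing matters: a block word of weight 1 cannot cancel the image 0, as the columns
  of the confounding matrix are nonzero when \<open>B\<close> has full column rank.
\<close>

lemma block_confounded_word:
  fixes T B :: "'a::{finite,field} mat"
  assumes dims: "dim_row B = dim_row T"
    and w: "w \<in> carrier_vec (dim_col T)" "T *\<^sub>v w \<in> (\<lambda>l. B *\<^sub>v l) ` carrier_vec (dim_col B)"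
      "T *\<^sub>v w \<noteq> 0\<^sub>v (dim_row T)"
  shows "w \<in> fst ` confounded_words T B (hamming_weight w)"
proof -
  have B: "B \<in> carrier_mat (dim_row T) (dim_col B)" using dims by (metis carrier_matI)
  obtain l where l: "l \<in> carrier_vec (dim_col B)" "T *\<^sub>v w = B *\<^sub>v l" using w(2) by auto
  have neg: "B *\<^sub>v (-1 \<cdot>\<^sub>v l) = -1 \<cdot>\<^sub>v (B *\<^sub>v l)" by (rule mult_mat_vec[OF B l(1)])
  have "B *\<^sub>v (-1 \<cdot>\<^sub>v l) \<noteq> 0\<^sub>v (dim_row B)"
  proof
    assume "B *\<^sub>v (-1 \<cdot>\<^sub>v l) = 0\<^sub>v (dim_row B)"
    then have "-1 \<cdot>\<^sub>v (-1 \<cdot>\<^sub>v (B *\<^sub>v l)) = -1 \<cdot>\<^sub>v 0\<^sub>v (dim_row B)" using neg by simp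
    moreover have "-1 \<cdot>\<^sub>v 0\<^sub>v (dim_row B) = (0\<^sub>v (dim_row B) :: 'a vec)" by (intro eq_vecI) auto
    ultimately have "B *\<^sub>v l = 0\<^sub>v (dim_row B)" by (simp add: smult_smult_assoc)
    then show False using w(3) l(2) dims by simp
  qed
  then obtain w2 where w2: "w2 \<in> carrier_vec (L CARD('a) (dim_col B))" "hamming_weight w2 = 1"
    "confounding_matrix B *\<^sub>v w2 = B *\<^sub>v (-1 \<cdot>\<^sub>v l)"
    using confounded_with_block[of "-1 \<cdot>\<^sub>v l" B] l(1) by auto
  have "T *\<^sub>v w + confounding_matrix B *\<^sub>v w2 = 0\<^sub>v (dim_row T)"
    unfolding w2(3) neg l(2) using dims by (intro eq_vecI) auto
  then have "(w, w2) \<in> confounded_words T B (hamming_weight w)"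
    using w w2 by (simp add: confounded_words_def)
  then show ?thesis by (metis fst_conv imageI)
qed

text \<open>
  The unit word at position \<open>i\<close> has image \<open>col T i\<close>. This is nonzero because \<open>A\<^sub>1\<^sub>,\<^sub>0 = 0\<close>, so
  membership in the column space of \<open>B\<close> would make the word contribute to \<open>A\<^sub>1\<^sub>,\<^sub>1 = 0\<close>.
\<close>

lemma RME_col_notin:
  fixes T B :: "'a::{finite,field} mat"
  assumes "RME T B" "dim_row B = dim_row T" and i: "i < dim_col T"
  shows "col T i \<notin> (\<lambda>l. B *\<^sub>v l) ` carrier_vec (dim_col B)"
proof
  assume mem: "col T i \<in> (\<lambda>l. B *\<^sub>v l) ` carrier_vec (dim_col B)"
  let ?e = "1 \<cdot>\<^sub>v unit_vec (dim_col T) i :: 'a vec"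
  have T: "T \<in> carrier_mat (dim_row T) (dim_col T)" by simp
  have h: "hamming_weight ?e = 1" by (rule hamming_weight_smult_unit[OF i]) simp
  have Te: "T *\<^sub>v ?e = col T i" using mult_mat_smult_unit_vec[OF T i, of 1] by simp
  have "T *\<^sub>v ?e \<noteq> 0\<^sub>v (dim_row T)"
    using assms(1) h by (intro A0_eq_0_D[of T 1]) (auto simp: RME_def)
  then have "?e \<in> fst ` confounded_words T B (hamming_weight ?e)"
    using mem Te by (intro block_confounded_word[OF assms(2)]) auto
  then have "confounded_words T B 1 \<noteq> {}" unfolding h by auto
  then have "card (confounded_words T B 1) \<noteq> 0" by (simp add: finite_confounded_words)
  then show False using assms(1) card_field_ge_two[where 'a='a] by (simp add: RME_def A1_eq)
qed

text \<open>
  If \<open>t\<^sub>j - a t\<^sub>i \<in> W\<close>, then for each \<open>c \<noteq> 0\<close> the word with entry \<open>c\<close> at \<open>j\<close> and \<open>- c a\<close> at \<open>i\<close> is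
  confounded with a block effect: its image lies in \<open>W\<close>, and it is nonzero since \<open>A\<^sub>2\<^sub>,\<^sub>0 = 0\<close>. The
  support of the word recovers \<open>i < j\<close> and its entry at \<open>j\<close> recovers \<open>c\<close>, so there are at least
  \<open>(s - 1) P\<close> such words.
\<close>

lemma A1_two_ge_equivalent_pairs:
  fixes T B :: "'a::{finite,field} mat"
  assumes rme: "RME T B" and T: "T \<in> carrier_mat m n" and B: "B \<in> carrier_mat m p"
  defines "W \<equiv> (\<lambda>l. B *\<^sub>v l) ` carrier_vec p"
  shows "real (card {(i, j). i < j \<and> j < n \<and> col T j \<in> adjoin W (col T i)}) \<le> A1 T B 2"
proof -
  let ?P = "{(i, j). i < j \<and> j < n \<and> col T j \<in> adjoin W (col T i)}"
  have W: "vec_subspace m W" unfolding W_def by (rule vec_subspace_range[OF B])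
  have colc: "col T i \<in> carrier_vec m" for i using T by auto
  have notin: "col T i \<notin> W" if "i < n" for i
    using RME_col_notin[OF rme, of i] T B that by (auto simp: W_def)
  define a where "a i j = (SOME a. col T j - a \<cdot>\<^sub>v col T i \<in> W)" for i j
  have a: "col T j - a i j \<cdot>\<^sub>v col T i \<in> W" if "(i, j) \<in> ?P" for i j
    unfolding a_def by (rule someI_ex) (use that adjoin_iff[OF W colc colc] in auto)
  define word where "word = (\<lambda>(c, i, j). c \<cdot>\<^sub>v unit_vec n j - (c * a i j) \<cdot>\<^sub>v unit_vec n i)"
  let ?D = "(UNIV - {0::'a}) \<times> ?P"
  \<comment> \<open>Weight exactly 2 requires \<open>a \<noteq> 0\<close>, which holds because \<open>t\<^sub>j \<notin> W\<close>.\<close>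
  have a0: "a i j \<noteq> 0" if ij: "(i, j) \<in> ?P" for i j
  proof
    assume "a i j = 0"
    then have "col T j - a i j \<cdot>\<^sub>v col T i = col T j" using T by (intro eq_vecI) auto
    then show False using a[OF ij] notin[of j] ij by auto
  qed
  have idx: "word (c, i, j) $ x = (if x = j then c else if x = i then - (c * a i j) else 0)"
    if "(i, j) \<in> ?P" "x < n" for c i j x
    using that by (auto simp: word_def unit_vec_def)
  have dimw: "word (c, i, j) \<in> carrier_vec n" for c i j by (simp add: word_def)
  have supp: "{x. x < n \<and> word (c, i, j) $ x \<noteq> 0} = {i, j}" if "(i, j) \<in> ?P" "c \<noteq> 0" for c i j
    using that a0[OF that(1)] by (auto simp: idx[OF that(1)] split: if_splits)
  have "word ` ?D \<subseteq> fst ` confounded_words T B 2"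
  proof (rule image_subsetI)
    fix x assume "x \<in> ?D"
    then obtain c i j where x: "x = (c, i, j)" and c: "c \<noteq> 0" and ij: "(i, j) \<in> ?P" by auto
    have wt: "hamming_weight (word x) = 2"
      using supp[OF ij c] ij dimw[of c i j] unfolding x by (auto simp: hamming_weight_def)
    have ij': "i < n" "j < n" using ij by auto
    have "T *\<^sub>v word x = c \<cdot>\<^sub>v col T j - (c * a i j) \<cdot>\<^sub>v col T i"
      unfolding x word_def using T ij' mult_mat_smult_unit_vec[OF T]
      by (simp add: mult_minus_distrib_mat_vec[OF T])
    also have "\<dots> = c \<cdot>\<^sub>v (col T j - a i j \<cdot>\<^sub>v col T i)"
      using T by (intro eq_vecI) (auto simp: algebra_simps)
    finally have "T *\<^sub>v word x \<in> W" using vec_subspace_smult[OF W a[OF ij]] by simp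
    moreover have "T *\<^sub>v word x \<noteq> 0\<^sub>v (dim_row T)"
      using rme wt T dimw[of c i j] x by (intro A0_eq_0_D[of T 2]) (auto simp: RME_def)
    ultimately show "word x \<in> fst ` confounded_words T B 2"
      using block_confounded_word[of B T "word x"] wt T B dimw[of c i j] x by (auto simp: W_def)
  qed
  moreover have "inj_on word ?D"
  proof (rule inj_onI)
    fix x x' assume "x \<in> ?D" "x' \<in> ?D" and eq: "word x = word x'"
    obtain c i j where x: "x = (c, i, j)" and c: "c \<noteq> 0" and ij: "(i, j) \<in> ?P"
      using \<open>x \<in> ?D\<close> by auto
    obtain c' i' j' where x': "x' = (c', i', j')" and c': "c' \<noteq> 0" and ij': "(i', j') \<in> ?P"
      using \<open>x' \<in> ?D\<close> by auto
    have "{i, j} = {i', j'}" using supp[OF ij c] supp[OF ij' c'] eq x x' by auto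
    then have "i = i' \<and> j = j'" using ij ij' by (auto simp: doubleton_eq_iff)
    moreover from this have "c = c'"
      using arg_cong[OF eq, of "\<lambda>w. w $ j"] idx[OF ij, of j c] idx[OF ij', of j c'] ij
      unfolding x x' by simp
    ultimately show "x = x'" using x x' by simp
  qed
  ultimately have "card ?D \<le> card (fst ` confounded_words T B 2)"
    by (intro card_inj_on_le[of word] finite_imageI finite_confounded_words)
  also have "\<dots> \<le> card (confounded_words T B 2)"
    by (intro card_image_le finite_confounded_words)
  finally have "(CARD('a) - 1) * card ?P \<le> card (confounded_words T B 2)"
    by (simp add: card_cartesian_product card_Diff_singleton)
  then have "real ((CARD('a) - 1) * card ?P) \<le> real (card (confounded_words T B 2))"
    by (simp only: of_nat_le_iff)
  then show ?thesis using card_field_ge_two[where 'a='a]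
    by (simp add: A1_eq of_nat_diff field_simps)
qed

section \<open>The lower bound\<close>

theorem theorem2:
  fixes T B :: "'a::{finite,field} mat"
    and n k p s :: nat
    and J \<eta> :: real
  assumes "s = CARD('a)"
    and "n \<ge> 1" and "n - k \<ge> 1" and "p \<ge> 1"
    and "regular_block_design n k p T B"
    and "RME T B"
    and "J = real n * (real s powi (int n - int k - int p - 1) - 1)
              * inverse (real s powi (int n - int k - int p) - 1)"
    and "\<eta> = frac J"
  shows "A1 T B 2 \<ge>
    inverse (2 * (real s - 1)) *
      (- (real n * (real n + real s - 1))
       + real s powi (- (int n - int k - int p - 2)) *
           (real n ^ 2 + (real s powi (int n - int k - int p) - 1) * (J ^ 2 + \<eta> * (1 - \<eta>))))"
proof -
  define m where "m = n - k"
  define W where "W = (\<lambda>l. B *\<^sub>v l) ` carrier_vec p"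
  define P where "P = card {(i, j). i < j \<and> j < n \<and> col T j \<in> adjoin W (col T i)}"
  define q where "q = real (card (orth m W))"
  have T: "T \<in> carrier_mat m n" and B: "B \<in> carrier_mat m p" and rank: "vec_space.rank m B = p"
    using assms(5) by (auto simp: regular_block_design_def m_def)
  have W: "vec_subspace m W" unfolding W_def by (rule vec_subspace_range[OF B])
  have cW: "card W = s ^ p" unfolding W_def
    using card_image[OF full_column_rank_inj[OF B rank]] card_carrier_vec_finite[of p, where 'a='a]
      assms(1) by simp
  have t: "col T i \<in> carrier_vec m - W" if "i < n" for i
    using RME_col_notin[OF assms(6), of i] T B that by (auto simp: W_def)
  have s: "real s > 1" using card_field_ge_two[where 'a='a] assms(1) by simp
  \<comment> \<open>Adjoining a column to \<open>W\<close> gives a subspace of order \<open>s^(p+1)\<close>, whose order divides \<open>s^m\<close>.\<close>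
  have "p < m"
  proof -
    have "col T 0 \<in> carrier_vec m - W" using t[of 0] assms(2) by simp
    then have "s * s ^ p * card {y \<in> orth m W. col T 0 \<bullet> y = 0} = s ^ m"
      using card_orth_hyperplane[OF W, of "col T 0"] cW assms(1) by simp
    then have "s ^ Suc p dvd s ^ m" by (metis dvd_triv_left power_Suc)
    moreover have "s ^ m > 0" using s by simp
    ultimately have "s ^ Suc p \<le> s ^ m" by (rule dvd_imp_le)
    then show ?thesis using s power_le_imp_le_exp[of s "Suc p" m] by simp
  qed
  have "real s ^ p * q = real s ^ m"
    using arg_cong[OF card_orth[OF W], of real] cW assms(1) by (simp add: q_def)
  also have "\<dots> = real s ^ p * real s ^ (m - p)" using \<open>p < m\<close> by (simp flip: power_add)
  finally have q: "q = real s ^ (m - p)" using s by simp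
  have exp: "int n - int k - int p = int (m - p)"
    using \<open>p < m\<close> assms(3) by (simp add: m_def of_nat_diff)
  have powi: "real s powi (int n - int k - int p) = q"
    "real s powi (int n - int k - int p - 1) = q / s"
    "real s powi (- (int n - int k - int p - 2)) = (real s)\<^sup>2 / q"
    unfolding exp q using s
    by (simp_all add: power_int_diff power_int_minus)
  have q1: "q > 1" unfolding q using s \<open>p < m\<close> by (intro one_less_power) auto
  have "J = n * (q / s - 1) / (q - 1)"
    unfolding assms(7) powi by (simp add: divide_inverse)
  from equivalent_pairs_bound[where t = "col T" and n = n and J = J, OF W t,
    folded assms(1) q_def, OF _ q1 this]
  have "(real n)\<^sup>2 + (q - 1) * (J\<^sup>2 + \<eta> * (1 - \<eta>))
      \<le> q / (real s)\<^sup>2 * (real n * (real n + real s - 1) + 2 * (real s - 1) * P)"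
    unfolding assms(8) P_def by simp
  then have "(real s)\<^sup>2 / q * ((real n)\<^sup>2 + (q - 1) * (J\<^sup>2 + \<eta> * (1 - \<eta>)))
      \<le> (real s)\<^sup>2 / q * (q / (real s)\<^sup>2 * (real n * (real n + real s - 1) + 2 * (real s - 1) * P))"
    using q1 by (intro mult_left_mono) auto
  also have "\<dots> = real n * (real n + real s - 1) + 2 * (real s - 1) * P" using q1 s by simp
  finally have "inverse (2 * (real s - 1)) * (- (real n * (real n + real s - 1))
      + (real s)\<^sup>2 / q * ((real n)\<^sup>2 + (q - 1) * (J\<^sup>2 + \<eta> * (1 - \<eta>)))) \<le> P"
    using s by (simp add: field_simps)
  also have "\<dots> \<le> A1 T B 2"
    unfolding P_def W_def by (rule A1_two_ge_equivalent_pairs[OF assms(6) T B])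
  finally show ?thesis unfolding powi by simp
qed

end
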